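(* Let $\alpha\in(0,1)$ and let $Q^t:\mathcal M\to\mathcal M$ for $t\in[0,+\infty)$. Suppose for every $t\in(0,+\infty)$ the map $Q^t$ satisfies: (i) if $u_k\in\mathcal M$ converge to $u\in\mathcal M$ uniformly on every bounded interval, then $Q^t[u_k]\to Q^t[u]$ almost everywhere; (ii) $u_1\le u_2$ implies $Q^t[u_1]\le Q^t[u_2]$; (iii) $T_{x_0}Q^t=Q^tT_{x_0}$ for all $x_0\in\mathbb R$, where $(T_{x_0}[u])(\cdot)=u(\cdot-x_0)$; (iv) $Q^t[\alpha]=\alpha$, and for constant functions $\gamma$: $0<\gamma<\alpha$ implies $Q^t[\gamma]<\gamma$, and $\alpha<\gamma<1$ implies $\gamma<Q^t[\gamma]$. Suppose moreover: (a) $Q^t\circ Q^s=Q^{t+s}$ for all $t,s\ge0$; (b) if $t_k\ge0$, $t_k\to0$ and $u\in\mathcal M$, then $Q^{t_k}[u]\to u$ almost everywhere; (c) whenever constants $c_-,c_+$ and $\phi_-,\phi_+\in\mathcal M$ with $\phi_-(-\infty)=0$, $\phi_-(+\infty)=\alpha$, $\phi_+(-\infty)=\alpha$, $\phi_+(+\infty)=1$ satisfy $(Q^t[\phi_-])(x-c_-t)\equiv\phi_-(x)$ and $(Q^t[\phi_+])(x-c_+t)\equiv\phi_+(x)$ for all $t\ge0$, one has $c_-<c_+$. Suppose a constant $\underline c$ and $\underline\psi\in\mathcal M$ with $\underline\psi(0)=0$, $\underline\psi(+\infty)\in(\alpha,1]$ satisfy $\underline\psi(x)\le(Q^t[\underline\psi])(x-\underline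 ct)$ for all $t\ge0$, and a constant $\overline c$ and $\overline\psi\in\mathcal M$ with $\overline\psi(-\infty)\in[0,\alpha)$, $\overline\psi(0)=1$ satisfy $(Q^t[\overline\psi])(x-\overline ct)\le\overline\psi(x)$ for all $t\ge0$. Then there exist $c\in[\underline c,\overline c]$ and $\phi\in\mathcal M$ with $\phi(-\infty)=0$, $\phi(+\infty)=1$ such that $(Q^t[\phi])(x-ct)\equiv\phi(x)$ for all $t\in[0,+\infty)$.
   Context: $\mathcal M$ denotes the set of monotone nondecreasing, left continuous functions $u$ on $\mathbb R$ with $0\le u\le 1$. Constants are regarded as constant functions in $\mathcal M$. *)

theory Defs
  imports "HOL-Analysis.Analysis"
begin

definition MM :: "(real \<Rightarrow> real) set" where
  "MM = {u. mono u \<and> (\<forall>x. continuous (at_left x) u) \<and> (\<forall>x. 0 \<le> u x \<and> u x \<le> 1)}"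

end

theory Submission
  imports Defs "HOL-Probability.Helly_Selection"
begin

text \<open>
  A front of the time-\<open>\<tau>\<close> map that travels at a position-dependent speed always exists: let the speed
  \<open>c\<^sub>\<epsilon>(x)\<close> decrease from \<open>cu\<close> to \<open>cl\<close> with slope at most \<open>\<epsilon>\<close> in \<open>x\<close>. Translates of \<open>psil\<close> far to the
  right and of \<open>psiu\<close> far to the left are then an ordered pair of a lower and an upper solution of
  \<open>U(x) = Q\<^sup>\<tau>[U](x - c\<^sub>\<epsilon>(x) \<tau>)\<close>, and Knaster-Tarski gives a solution \<open>U\<close> between them. Centre \<open>U\<close> where it
  crosses a level \<open>lm < \<alpha>\<close> and where it crosses a level \<open>lp > \<alpha>\<close>. As \<open>\<epsilon> \<rightarrow> 0\<close>, Helly selection yields two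
  travelling waves of \<open>Q\<^sup>\<tau>\<close>, and the one through \<open>lp\<close>, centred further to the right, is not faster than
  the one through \<open>lm\<close>. With \<open>\<tau> = 2\<^sup>-\<^sup>n \<rightarrow> 0\<close> the pair persists and solves the wave equation for all dyadic
  times, hence by (b) for all times. The end states of a wave lie in \<open>{0, \<alpha>, 1}\<close>. If neither wave joined
  0 to 1, they would join 0 to \<open>\<alpha>\<close> and \<open>\<alpha>\<close> to 1 with speeds in the order excluded by (c).
\<close>

section \<open>Monotone left-continuous functions\<close>

text \<open>For a nondecreasing \<open>u\<close> the left limit at \<open>x\<close> is the supremum
  of the values at points \<open>y < x\<close>, so a single \<open>y\<close> per \<open>e\<close>
  already witnesses left continuity.\<close>

lemma MM_iff:
  "u \<in> MM \<longleftrightarrow> mono u \<and> (\<forall>x. 0 \<le> u x \<and> u x \<le> 1) \<and> (\<forall>x e. 0 < e \<longrightarrow> (\<exists>y<x. u x < u y + e))"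
proof -
  have "continuous (at_left x) u \<longleftrightarrow> (\<forall>e>0. \<exists>y<x. u x < u y + e)" if m: "mono u" for x
  proof
    assume "continuous (at_left x) u"
    then have lim: "(u \<longlongrightarrow> u x) (at_left x)"
      by (simp add: continuous_within)
    show "\<forall>e>0. \<exists>y<x. u x < u y + e"
    proof safe
      fix e :: real assume "e > 0"
      then have "\<forall>\<^sub>F y in at_left x. u x - e < u y"
        using order_tendstoD(1)[OF lim, of "u x - e"] by simp
      then obtain b where "b < x" "\<forall>y>b. y < x \<longrightarrow> u x - e < u y"
        unfolding eventually_at_left_field by blast
      then show "\<exists>y<x. u x < u y + e"
        by (intro exI[of _ "(b + x) / 2"]) (simp add: diff_less_eq)
    qed
  next
    assume left: "\<forall>e>0. \<exists>y<x. u x < u y + e"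
    have "(u \<longlongrightarrow> u x) (at_left x)"
    proof (rule order_tendstoI)
      fix a assume "a < u x"
      then obtain y where y: "y < x" "u x < u y + (u x - a)"
        using left by (metis diff_gt_0_iff_gt)
      show "\<forall>\<^sub>F z in at_left x. a < u z"
        unfolding eventually_at_left_field
      proof (intro exI[of _ y] conjI allI impI)
        fix z assume "y < z"
        then have "u y \<le> u z" using m by (simp add: monoD)
        then show "a < u z" using y by simp
      qed (use y in simp)
    next
      fix a assume "u x < a"
      have "u z < a" if "z < x" for z
        using monoD[OF m, of z x] that \<open>u x < a\<close> by simp
      then show "\<forall>\<^sub>F z in at_left x. u z < a"
        unfolding eventually_at_left_field by (intro exI[of _ "x - 1"]) simp
    qed
    then show "continuous (at_left x) u"
      by (simp add: continuous_within)
  qed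
  then show ?thesis
    unfolding MM_def by auto
qed

lemma MM_mono: "u \<in> MM \<Longrightarrow> x \<le> y \<Longrightarrow> u x \<le> u y"
  by (simp add: MM_iff monoD)

lemma MM_bounds: "u \<in> MM \<Longrightarrow> 0 \<le> u x" "u \<in> MM \<Longrightarrow> u x \<le> 1"
  by (simp_all add: MM_iff)

lemma MM_left: "u \<in> MM \<Longrightarrow> 0 < e \<Longrightarrow> \<exists>y<x. u x < u y + e"
  by (simp add: MM_iff)

lemma MM_left2:
  assumes "u \<in> MM" "v \<in> MM" "0 < e"
  shows "\<exists>y<x. u x < u y + e \<and> v x < v y + e"
proof -
  obtain y z where "y < x" "u x < u y + e" "z < x" "v x < v z + e"
    using MM_left[OF assms(1,3)] MM_left[OF assms(2,3)] by blast
  moreover have "u y \<le> u (max y z)" "v z \<le> v (max y z)"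
    using assms by (simp_all add: MM_mono)
  ultimately show ?thesis
    by (intro exI[of _ "max y z"]) simp
qed

lemma MM_le_left:
  assumes "u \<in> MM" "\<And>y. y < x \<Longrightarrow> u y \<le> a"
  shows "u x \<le> a"
proof (rule field_le_epsilon)
  fix e :: real assume "e > 0"
  then obtain y where "y < x" "u x < u y + e"
    using MM_left[OF assms(1)] by blast
  with assms(2)[of y] show "u x \<le> a + e" by simp
qed

lemma MM_const: "0 \<le> a \<Longrightarrow> a \<le> 1 \<Longrightarrow> (\<lambda>_. a) \<in> MM"
  by (simp add: MM_iff mono_def lt_ex)

lemma MM_max:
  assumes "u \<in> MM" "v \<in> MM"
  shows "(\<lambda>x. max (u x) (v x)) \<in> MM"
  unfolding MM_iff
proof (intro conjI allI impI)
  show "mono (\<lambda>x. max (u x) (v x))"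
    by (intro monoI max.mono MM_mono[OF assms(1)] MM_mono[OF assms(2)])
next
  fix x e :: real assume "0 < e"
  then show "\<exists>y<x. max (u x) (v x) < max (u y) (v y) + e"
    using MM_left2[OF assms, of e x] by (auto simp: max_def intro!: exI)
qed (use MM_bounds assms in \<open>auto simp: max_def\<close>)

lemma MM_min:
  assumes "u \<in> MM" "v \<in> MM"
  shows "(\<lambda>x. min (u x) (v x)) \<in> MM"
  unfolding MM_iff
proof (intro conjI allI impI)
  show "mono (\<lambda>x. min (u x) (v x))"
    by (intro monoI min.mono MM_mono[OF assms(1)] MM_mono[OF assms(2)])
next
  fix x e :: real assume "0 < e"
  then show "\<exists>y<x. min (u x) (v x) < min (u y) (v y) + e"
    using MM_left2[OF assms, of e x] by (auto simp: min_def intro!: exI)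
qed (use MM_bounds assms in \<open>auto simp: min_def\<close>)

lemma MM_comp:
  assumes "u \<in> MM" "strict_mono g" "continuous_on UNIV g"
  shows "(\<lambda>x. u (g x)) \<in> MM"
  unfolding MM_iff
proof (intro conjI allI impI)
  show "mono (\<lambda>x. u (g x))"
    by (intro monoI MM_mono[OF assms(1)]) (simp add: strict_mono_less_eq[OF assms(2)])
next
  fix x e :: real assume "0 < e"
  then obtain y where y: "y < g x" "u (g x) < u y + e"
    using MM_left[OF assms(1)] by blast
  have "(g \<longlongrightarrow> g x) (at_left x)"
    using assms(3) by (meson UNIV_I continuous_on_def tendsto_within_subset subset_UNIV)
  then have "\<forall>\<^sub>F z in at_left x. y < g z"
    using y by (simp add: order_tendstoD)
  then obtain b where "b < x" "\<forall>z>b. z < x \<longrightarrow> y < g z"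
    unfolding eventually_at_left_field by blast
  then have "(b + x) / 2 < x" "y < g ((b + x) / 2)" by simp_all
  moreover have "u y \<le> u (g ((b + x) / 2))"
    using calculation assms by (simp add: MM_mono)
  ultimately show "\<exists>y<x. u (g x) < u (g y) + e"
    using y by (intro exI[of _ "(b + x) / 2"]) simp
qed (use MM_bounds assms in auto)

lemma MM_shift: "u \<in> MM \<Longrightarrow> (\<lambda>x. u (x - a)) \<in> MM"
  by (rule MM_comp) (auto simp: strict_mono_def intro!: continuous_intros)

lemma MM_shift': "u \<in> MM \<Longrightarrow> (\<lambda>x. u (x + a)) \<in> MM"
  using MM_shift[of u "- a"] by simp

text \<open>Among nondecreasing functions left continuity is lower semicontinuity, which survives
  arbitrary suprema. This makes the Knaster-Tarski argument possible inside
  \<open>MM\<close>.\<close>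

lemma MM_Sup:
  assumes "S \<subseteq> MM" "S \<noteq> {}"
  shows "(\<lambda>x. SUP u\<in>S. u x) \<in> MM"
proof -
  have bdd: "bdd_above ((\<lambda>u. u x) ` S)" for x
    using assms MM_bounds by (intro bdd_aboveI2[of _ _ 1]) auto
  have upper: "u x \<le> (SUP u\<in>S. u x)" if "u \<in> S" for u x
    using that bdd by (rule cSUP_upper)
  show ?thesis
    unfolding MM_iff
  proof (intro conjI allI impI)
    show "mono (\<lambda>x. SUP u\<in>S. u x)"
    proof (rule monoI)
      fix x y :: real assume "x \<le> y"
      show "(SUP u\<in>S. u x) \<le> (SUP u\<in>S. u y)"
      proof (rule cSUP_least[OF assms(2)])
        fix u assume "u \<in> S"
        then have "u x \<le> u y" using assms \<open>x \<le> y\<close> by (auto intro: MM_mono)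
        also have "\<dots> \<le> (SUP u\<in>S. u y)" by (rule upper[OF \<open>u \<in> S\<close>])
        finally show "u x \<le> (SUP u\<in>S. u y)" .
      qed
    qed
  next
    fix x :: real
    obtain u where u: "u \<in> S" using assms by auto
    then have "0 \<le> u x" using assms MM_bounds by auto
    then show "0 \<le> (SUP u\<in>S. u x)" using upper[OF u, of x] by simp
    show "(SUP u\<in>S. u x) \<le> 1"
      using assms MM_bounds by (intro cSUP_least) auto
  next
    fix x e :: real assume "0 < e"
    then have "(SUP u\<in>S. u x) - e / 2 < (SUP u\<in>S. u x)" by simp
    then obtain u where u: "u \<in> S" "(SUP u\<in>S. u x) - e / 2 < u x"
      using less_cSUP_iff[OF assms(2) bdd, of _ x] by blast
    moreover obtain y where "y < x" "u x < u y + e / 2"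
      using MM_left[of u "e / 2"] u assms \<open>0 < e\<close> by auto
    ultimately show "\<exists>y<x. (SUP u\<in>S. u x) < (SUP u\<in>S. u y) + e"
      using upper[OF u(1), of y] by (intro exI[of _ y]) simp
  qed
qed

section \<open>Weak convergence\<close>

text \<open>For monotone functions this is convergence at every continuity point of the limit.\<close>

definition wconv :: "(nat \<Rightarrow> real \<Rightarrow> real) \<Rightarrow> (real \<Rightarrow> real) \<Rightarrow> bool" where
  "wconv uk u \<longleftrightarrow> (\<forall>x y e. x < y \<longrightarrow> 0 < e \<longrightarrow>
     (\<forall>\<^sub>F k in sequentially. uk k x \<le> u y + e \<and> u x \<le> uk k y + e))"

lemma wconvD:
  assumes "wconv uk u" "x < y" "0 < e"
  shows "\<forall>\<^sub>F k in sequentially. uk k x \<le> u y + e"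
    and "\<forall>\<^sub>F k in sequentially. u x \<le> uk k y + e"
  using assms unfolding wconv_def eventually_conj_iff by blast+

lemma wconv_const: "u \<in> MM \<Longrightarrow> wconv (\<lambda>_. u) u"
  by (simp add: wconv_def add_increasing2 MM_mono)

lemma wconv_subseq: "wconv uk u \<Longrightarrow> strict_mono r \<Longrightarrow> wconv (\<lambda>k. uk (r k)) u"
  unfolding wconv_def by (auto dest: eventually_subseq)

text \<open>The gap between \<open>x\<close> and \<open>y\<close> in \<open>wconv\<close> determines
  a limit up to arbitrarily small translations; left continuity closes the gap.\<close>

lemma wconv_unique:
  assumes "wconv uk u" "wconv uk v" "u \<in> MM" "v \<in> MM"
  shows "u = v"
proof -
  have *: "u x \<le> v x" if uv: "wconv uk u" "wconv uk v" "u \<in> MM" for u v x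
  proof (rule MM_le_left[OF that(3)], rule field_le_epsilon)
    fix y e :: real assume "y < x" "0 < e"
    then have "\<forall>\<^sub>F k in sequentially. u y \<le> uk k ((y + x) / 2) + e / 2 \<and>
                 uk k ((y + x) / 2) \<le> v x + e / 2"
      using wconvD(2)[OF uv(1), of y "(y + x) / 2" "e / 2"]
        wconvD(1)[OF uv(2), of "(y + x) / 2" x "e / 2"] by (simp add: eventually_conj_iff)
    then obtain k where "u y \<le> uk k ((y + x) / 2) + e / 2" "uk k ((y + x) / 2) \<le> v x + e / 2"
      unfolding eventually_sequentially by blast
    then show "u y \<le> v x + e" by simp
  qed
  show ?thesis
    using *[OF assms(1,2,3)] *[OF assms(2,1,4)] by (intro ext antisym)
qed

text \<open>A nonempty open interval has positive measure, so it meets every set of full measure.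
  This extracts points of convergence from the almost-everywhere statements in (i) and (b).\<close>

lemma AE_interval_witness:
  fixes x y :: real
  assumes "AE z in lborel. R z" "x < y"
  obtains z where "x < z" "z < y" "R z"
proof -
  have "\<exists>z. x < z \<and> z < y \<and> R z"
  proof (rule ccontr)
    assume "\<not> ?thesis"
    with assms have "AE z in lborel. z \<notin> {x<..<y}" by auto
    then have "emeasure lborel {x<..<y} = 0"
      by (subst (asm) AE_iff_measurable[where N="{x<..<y}"]) auto
    with assms show False by simp
  qed
  then show thesis using that by blast
qed

lemma wconv_AE:
  assumes "\<And>k. uk k \<in> MM" "u \<in> MM" "AE z in lborel. (\<lambda>k. uk k z) \<longlonglongrightarrow> u z"
  shows "wconv uk u"
  unfolding wconv_def
proof (intro allI impI)
  fix x y e :: real assume "x < y" "0 < e"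
  from assms(3) \<open>x < y\<close> obtain z where z: "x < z" "z < y" "(\<lambda>k. uk k z) \<longlonglongrightarrow> u z"
    by (rule AE_interval_witness)
  have "\<forall>\<^sub>F k in sequentially. \<bar>uk k z - u z\<bar> < e"
    using z(3) \<open>0 < e\<close> by (auto simp: tendsto_iff dist_real_def)
  then show "\<forall>\<^sub>F k in sequentially. uk k x \<le> u y + e \<and> u x \<le> uk k y + e"
  proof eventually_elim
    case (elim k)
    have "uk k x \<le> uk k z" "uk k z \<le> uk k y" "u x \<le> u z" "u z \<le> u y"
      using z assms by (simp_all add: MM_mono)
    then show ?case using elim by linarith
  qed
qed

text \<open>The gap between \<open>x\<close> and \<open>y\<close> absorbs both the error of the
  displacement and the loss in \<open>wconv\<close>. The displacement may depend on
  \<open>x\<close>, as the position-dependent speed demands.\<close>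

lemma wconv_moving_shift:
  assumes "wconv uk u" "\<And>k. uk k \<in> MM" "\<And>x. (\<lambda>k. d k x) \<longlonglongrightarrow> c"
  shows "wconv (\<lambda>k x. uk k (x - d k x)) (\<lambda>x. u (x - c))"
  unfolding wconv_def
proof (intro allI impI)
  fix x y e :: real assume "x < y" "0 < e"
  define h where "h = (y - x) / 3"
  have "h > 0" using \<open>x < y\<close> by (simp add: h_def)
  have "\<forall>\<^sub>F k in sequentially. \<bar>d k x - c\<bar> < h"  "\<forall>\<^sub>F k in sequentially. \<bar>d k y - c\<bar> < h"
    using assms(3) \<open>0 < h\<close> by (auto simp: tendsto_iff dist_real_def)
  moreover have "\<forall>\<^sub>F k in sequentially. uk k (x - c + h) \<le> u (y - c) + e"
    by (rule wconvD[OF assms(1)]) (use \<open>0 < e\<close> \<open>x < y\<close> in \<open>simp_all add: h_def field_simps\<close>)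
  moreover have "\<forall>\<^sub>F k in sequentially. u (x - c) \<le> uk k (y - c - h) + e"
    by (rule wconvD[OF assms(1)]) (use \<open>0 < e\<close> \<open>x < y\<close> in \<open>simp_all add: h_def field_simps\<close>)
  ultimately show "\<forall>\<^sub>F k in sequentially. uk k (x - d k x) \<le> u (y - c) + e \<and>
      u (x - c) \<le> uk k (y - d k y) + e"
  proof eventually_elim
    case (elim k)
    have "uk k (x - d k x) \<le> uk k (x - c + h)" "uk k (y - c - h) \<le> uk k (y - d k y)"
      using elim by (auto intro!: MM_mono[OF assms(2)])
    then show ?case using elim by linarith
  qed
qed

lemma MM_Helly:
  fixes uk :: "nat \<Rightarrow> real \<Rightarrow> real"
  assumes "\<And>k. uk k \<in> MM"
  shows "\<exists>r u. strict_mono r \<and> u \<in> MM \<and> wconv (\<lambda>k. uk (r k)) u"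
proof -
  \<comment> \<open>\<open>Helly_selection\<close> is about right-continuous functions; reflection
    through the origin keeps monotonicity and exchanges left and right continuity.\<close>
  let ?f = "\<lambda>k x. - uk k (- x)"
  have "continuous (at_right x) (?f k)" for k x
  proof -
    have "(uk k \<longlongrightarrow> uk k (- x)) (at_left (- x))"
      using assms[of k] by (simp add: MM_def continuous_within)
    then show ?thesis
      unfolding continuous_within at_left_minus filterlim_filtermap
      by (auto intro: tendsto_minus)
  qed
  moreover have "mono (?f k)" for k
    using MM_mono[OF assms] by (simp add: mono_def)
  moreover have "\<bar>?f k x\<bar> \<le> 1" for k x
    using MM_bounds[OF assms, of k "- x"] by simp
  ultimately obtain r F where r: "strict_mono r" and F: "\<And>x. continuous (at_right x) F"
    "mono F" "\<And>x. continuous (at x) F \<Longrightarrow> (\<lambda>k. ?f (r k) x) \<longlonglongrightarrow> F x"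
    using Helly_selection[of ?f 1] by metis
  define u where "u = (\<lambda>x. - F (- x))"
  \<comment> \<open>The monotone limit \<open>F\<close> has countably many discontinuities, so every
    interval contains a point of convergence.\<close>
  have dense: "\<exists>z. x < z \<and> z < y \<and> (\<lambda>k. uk (r k) z) \<longlonglongrightarrow> u z" if "x < y" for x y
  proof -
    have "countable {z. \<not> continuous (at z) F}"
      using F(2) by (rule mono_ctble_discont)
    moreover have "uncountable {-y<..<-x}"
      using that by (simp add: uncountable_open_interval)
    ultimately obtain z where z: "-y < z" "z < -x" "continuous (at z) F"
      by (metis (mono_tags, lifting) countable_subset greaterThanLessThan_iff mem_Collect_eq subsetI)
    then have "(\<lambda>k. - uk (r k) (- z)) \<longlonglongrightarrow> F z" using F(3) by blast
    then have "(\<lambda>k. uk (r k) (- z)) \<longlonglongrightarrow> u (- z)"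
      using tendsto_minus[of "\<lambda>k. - uk (r k) (- z)" "F z"] by (simp add: u_def)
    then show ?thesis using z by (intro exI[of _ "- z"]) auto
  qed
  have mono_u: "mono u"
    using F(2) by (auto simp: mono_def u_def)
  have "0 \<le> u x" "u x \<le> 1" for x
  proof -
    obtain z where z: "x - 1 < z" "z < x" "(\<lambda>k. uk (r k) z) \<longlonglongrightarrow> u z"
      using dense[of "x - 1" x] by auto
    have "0 \<le> u z"
      by (rule LIMSEQ_le_const[OF z(3)]) (use MM_bounds assms in blast)
    then show "0 \<le> u x" using monoD[OF mono_u, of z x] z by simp
    obtain z where z: "x < z" "z < x + 1" "(\<lambda>k. uk (r k) z) \<longlonglongrightarrow> u z"
      using dense[of x "x + 1"] by auto
    have "u z \<le> 1"
      by (rule LIMSEQ_le_const2[OF z(3)]) (use MM_bounds assms in blast)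
    then show "u x \<le> 1" using monoD[OF mono_u, of x z] z by simp
  qed
  moreover have "continuous (at_left x) u" for x
  proof -
    have "(F \<longlongrightarrow> F (- x)) (at_right (- x))"
      using F(1)[of "- x"] by (simp add: continuous_within)
    then show ?thesis
      unfolding continuous_within at_right_minus filterlim_filtermap u_def
      by (auto intro: tendsto_minus)
  qed
  ultimately have "u \<in> MM"
    using mono_u by (simp add: MM_def)
  moreover have "wconv (\<lambda>k. uk (r k)) u"
    unfolding wconv_def
  proof (intro allI impI)
    fix x y e :: real assume "x < y" "0 < e"
    obtain z where z: "x < z" "z < y" "(\<lambda>k. uk (r k) z) \<longlonglongrightarrow> u z"
      using dense[OF \<open>x < y\<close>] by auto
    have "\<forall>\<^sub>F k in sequentially. \<bar>uk (r k) z - u z\<bar> < e"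
      using z(3) \<open>0 < e\<close> by (auto simp: tendsto_iff dist_real_def)
    then show "\<forall>\<^sub>F k in sequentially. uk (r k) x \<le> u y + e \<and> u x \<le> uk (r k) y + e"
    proof eventually_elim
      case (elim k)
      have "uk (r k) x \<le> uk (r k) z" "uk (r k) z \<le> uk (r k) y" "u x \<le> u z" "u z \<le> u y"
        using z assms \<open>u \<in> MM\<close> by (simp_all add: MM_mono)
      then show ?case using elim by linarith
    qed
  qed
  ultimately show ?thesis using r by blast
qed

text \<open>By monotonicity a short interval needs only two comparison points; bisection extends the
  estimate to all of \<open>{a..b}\<close>.\<close>

lemma wconv_locally_uniform:
  assumes "wconv uk u" "\<And>k. uk k \<in> MM" "u \<in> MM" "0 < h" "0 < e"
  shows "\<forall>\<^sub>F k in sequentially. \<forall>z\<in>{a..b}. uk k z \<le> u (z + h) + e \<and> u (z - h) \<le> uk k z + e"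
proof (cases "a \<le> b")
  case True
  then show ?thesis
  proof (induction rule: Bolzano)
    case (trans a b c)
    from trans(1,2) show ?case
      by eventually_elim (metis atLeastAtMost_iff linear)
  next
    case (local x)
    have ev: "\<forall>\<^sub>F k in sequentially. uk k (x + h/3) \<le> u (x + 2*h/3) + e"
      "\<forall>\<^sub>F k in sequentially. u (x - 2*h/3) \<le> uk k (x - h/3) + e"
      using assms by (auto intro!: wconvD[OF assms(1)])
    \<comment> \<open>An interval around \<open>x\<close> shorter than \<open>h/3\<close> lies
      between \<open>x - h/3\<close> and \<open>x + h/3\<close>, and translating its points by
      \<open>h\<close> to either side passes \<open>x + 2*h/3\<close> and
      \<open>x - 2*h/3\<close>.\<close>
    show ?case
    proof (intro exI[of _ "h/3"] conjI allI impI)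
      fix a b assume ab: "a \<le> x \<and> x \<le> b \<and> b - a < h / 3"
      from ev show "\<forall>\<^sub>F k in sequentially. \<forall>z\<in>{a..b}. uk k z \<le> u (z + h) + e \<and> u (z - h) \<le> uk k z + e"
      proof eventually_elim
        case (elim k)
        show ?case
        proof
          fix z assume "z \<in> {a..b}"
          then have "uk k z \<le> uk k (x + h/3)" "u (x + 2*h/3) \<le> u (z + h)"
            "u (z - h) \<le> u (x - 2*h/3)" "uk k (x - h/3) \<le> uk k z"
            using ab by (auto intro!: MM_mono[OF assms(2)] MM_mono[OF assms(3)])
          then show "uk k z \<le> u (z + h) + e \<and> u (z - h) \<le> uk k z + e"
            using elim by linarith
        qed
      qed
    qed (use assms in simp)
  qed
qed simp

text \<open>
  Taking the maximum (minimum) with a translate of the limit turns weak convergence into the locally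
  uniform convergence that hypothesis (i) requires, at the price of an arbitrarily small translation.
\<close>

lemma uniform_limit_max_shift:
  assumes "wconv uk u" "\<And>k. uk k \<in> MM" "u \<in> MM" "0 < h"
  shows "uniform_limit {a..b} (\<lambda>k x. max (uk k x) (u (x + h))) (\<lambda>x. u (x + h)) sequentially"
proof (rule uniform_limitI)
  fix e :: real assume "0 < e"
  then have "\<forall>\<^sub>F k in sequentially. \<forall>z\<in>{a..b}. uk k z \<le> u (z + h) + e/2 \<and> u (z - h) \<le> uk k z + e/2"
    by (intro wconv_locally_uniform assms) simp
  then show "\<forall>\<^sub>F k in sequentially. \<forall>x\<in>{a..b}. dist (max (uk k x) (u (x + h))) (u (x + h)) < e"
    by eventually_elim (use \<open>0 < e\<close> in \<open>fastforce simp: dist_real_def max_def\<close>)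
qed

lemma uniform_limit_min_shift:
  assumes "wconv uk u" "\<And>k. uk k \<in> MM" "u \<in> MM" "0 < h"
  shows "uniform_limit {a..b} (\<lambda>k x. min (uk k x) (u (x - h))) (\<lambda>x. u (x - h)) sequentially"
proof (rule uniform_limitI)
  fix e :: real assume "0 < e"
  then have "\<forall>\<^sub>F k in sequentially. \<forall>z\<in>{a..b}. uk k z \<le> u (z + h) + e/2 \<and> u (z - h) \<le> uk k z + e/2"
    by (intro wconv_locally_uniform assms) simp
  then show "\<forall>\<^sub>F k in sequentially. \<forall>x\<in>{a..b}. dist (min (uk k x) (u (x - h))) (u (x - h)) < e"
    by eventually_elim (use \<open>0 < e\<close> in \<open>fastforce simp: dist_real_def min_def\<close>)
qed

section \<open>Fixed points, level crossings and compactness\<close>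

text \<open>Knaster-Tarski: the supremum \<open>U\<close> of all \<open>u \<le> T u\<close> below
  \<open>b\<close> again has this property, and so does \<open>T U\<close>, which forces
  \<open>T U = U\<close>.\<close>

lemma MM_fixed_point:
  assumes maps: "\<And>u. u \<in> MM \<Longrightarrow> T u \<in> MM"
    and mono: "\<And>u v. u \<in> MM \<Longrightarrow> v \<in> MM \<Longrightarrow> u \<le> v \<Longrightarrow> T u \<le> T v"
    and a: "a \<in> MM" "a \<le> T a" and b: "b \<in> MM" "T b \<le> b" and ab: "a \<le> b"
  shows "\<exists>u\<in>MM. T u = u \<and> a \<le> u \<and> u \<le> b"
proof -
  define S where "S = {u \<in> MM. u \<le> T u \<and> u \<le> b}"
  define U where "U = (\<lambda>x. SUP u\<in>S. u x)"
  have aS: "a \<in> S" using a ab by (simp add: S_def)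
  have U: "U \<in> MM"
    unfolding U_def by (rule MM_Sup) (use aS in \<open>auto simp: S_def\<close>)
  have bdd: "bdd_above ((\<lambda>u. u x) ` S)" for x
    using MM_bounds by (intro bdd_aboveI2[of _ _ 1]) (auto simp: S_def)
  have upper: "u \<le> U" if "u \<in> S" for u
    unfolding U_def le_fun_def by (intro allI cSUP_upper that bdd)
  have least: "U \<le> v" if "\<And>u. u \<in> S \<Longrightarrow> u \<le> v" for v
    unfolding U_def le_fun_def using that aS by (auto intro!: cSUP_least dest: le_funD)
  have Ub: "U \<le> b" by (rule least) (simp add: S_def)
  have UT: "U \<le> T U"
  proof (rule least)
    fix u assume u: "u \<in> S"
    then have "u \<le> T u" by (simp add: S_def)
    also have "T u \<le> T U" using u U upper[OF u] by (intro mono) (simp_all add: S_def)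
    finally show "u \<le> T U" .
  qed
  have "T U \<le> T b" by (intro mono U b Ub)
  then have "T U \<in> S"
    using U UT b mono[OF U maps[OF U] UT] by (auto simp: S_def maps intro: order_trans)
  then have "T U \<le> U" by (rule upper)
  with UT have "T U = U" by simp
  then show ?thesis using U Ub upper[OF aS] by blast
qed

text \<open>Applied to \<open>- e * x\<close> with bounds \<open>cl\<close> and \<open>cu\<close>,
  this is a speed falling linearly from \<open>cu\<close> to \<open>cl\<close> and constant outside
  a bounded interval.\<close>

definition clip :: "real \<Rightarrow> real \<Rightarrow> real \<Rightarrow> real" where
  "clip a b x = max a (min b x)"

lemma clip_mono: "x \<le> y \<Longrightarrow> clip a b x \<le> clip a b y"
  by (auto simp: clip_def)

lemma clip_bounds: "a \<le> b \<Longrightarrow> a \<le> clip a b x" "a \<le> b \<Longrightarrow> clip a b x \<le> b"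
  by (auto simp: clip_def)

lemma clip_dist: "\<bar>clip a b x - clip a b y\<bar> \<le> \<bar>x - y\<bar>"
  by (auto simp: clip_def max_def min_def)

text \<open>The value at 0 is left free because a function in \<open>MM\<close> may jump across the
  level; in this form the normalisation also survives weak limits.\<close>

definition crosses :: "(real \<Rightarrow> real) \<Rightarrow> real \<Rightarrow> bool" where
  "crosses u a \<longleftrightarrow> (\<forall>x<0. u x \<le> a) \<and> (\<forall>x>0. a \<le> u x)"

text \<open>The crossing point is the supremum of the set where \<open>u\<close> is at most
  \<open>a\<close>; \<open>p\<close> makes this set nonempty and \<open>q\<close> bounds it.\<close>

lemma crosses_exists:
  assumes u: "u \<in> MM" and p: "u p < a" and q: "a < u q"
  shows "\<exists>y. crosses (\<lambda>x. u (x + y)) a"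
proof -
  define S where "S = {x. u x \<le> a}"
  have S: "S \<noteq> {}" "bdd_above S"
  proof -
    have "p \<in> S" using p by (simp add: S_def)
    then show "S \<noteq> {}" by blast
    have "x \<le> q" if "x \<in> S" for x
      using MM_mono[OF u, of q x] that q by (force simp: S_def)
    then show "bdd_above S" by (rule bdd_aboveI)
  qed
  have "u (x + Sup S) \<le> a" if "x < 0" for x
  proof -
    have "x + Sup S < Sup S" using that by simp
    then obtain z where "z \<in> S" "x + Sup S < z"
      using less_cSup_iff[OF S] by blast
    then show ?thesis using MM_mono[OF u, of "x + Sup S" z] by (simp add: S_def)
  qed
  moreover have "a \<le> u (x + Sup S)" if "x > 0" for x
    using cSup_upper[OF _ S(2), of "x + Sup S"] that by (force simp: S_def)
  ultimately show ?thesis by (auto simp: crosses_def)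
qed

text \<open>Comparing \<open>x\<close> with \<open>x / 2\<close> supplies the gap that
  \<open>wconv\<close> requires while staying on the same side of 0.\<close>

lemma crosses_wconv:
  assumes "wconv uk u" "\<And>k. crosses (uk k) a"
  shows "crosses u a"
proof -
  have "u x \<le> a" if "x < 0" for x
  proof (rule field_le_epsilon)
    fix e :: real assume "0 < e"
    then have "\<forall>\<^sub>F k in sequentially. u x \<le> uk k (x / 2) + e"
      using that by (intro wconvD[OF assms(1)]) simp_all
    then obtain k where "u x \<le> uk k (x / 2) + e"
      unfolding eventually_sequentially by blast
    moreover have "uk k (x / 2) \<le> a" using assms(2) that by (simp add: crosses_def)
    ultimately show "u x \<le> a + e" by simp
  qed
  moreover have "a \<le> u x" if "x > 0" for x
  proof (rule field_le_epsilon)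
    fix e :: real assume "0 < e"
    then have "\<forall>\<^sub>F k in sequentially. uk k (x / 2) \<le> u x + e"
      using that by (intro wconvD[OF assms(1)]) simp_all
    then obtain k where "uk k (x / 2) \<le> u x + e"
      unfolding eventually_sequentially by blast
    moreover have "a \<le> uk k (x / 2)" using assms(2) that by (simp add: crosses_def)
    ultimately show "a \<le> u x + e" by simp
  qed
  ultimately show ?thesis by (simp add: crosses_def)
qed

lemma bounded_subseq:
  fixes c :: "nat \<Rightarrow> real"
  assumes "\<And>k. c k \<in> {A..B}"
  shows "\<exists>r l. strict_mono r \<and> l \<in> {A..B} \<and> (\<lambda>k. c (r k)) \<longlonglongrightarrow> l"
proof -
  have "seq_compact {A..B}" by (simp add: compact_imp_seq_compact)
  then show ?thesis
    using assms unfolding seq_compact_def o_def by metis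
qed

text \<open>Four successive extractions. The lemma serves both limit passages, in the slope of the
  speed and in the time step.\<close>

lemma wave_data_subseq:
  fixes a b :: "nat \<Rightarrow> real"
  assumes "\<And>k. u k \<in> MM" "\<And>k. v k \<in> MM" "\<And>k. a k \<in> {A..B}" "\<And>k. b k \<in> {A..B}"
  shows "\<exists>r u' v' a' b'. strict_mono r \<and> u' \<in> MM \<and> v' \<in> MM \<and> a' \<in> {A..B} \<and> b' \<in> {A..B}
    \<and> wconv (\<lambda>k. u (r k)) u' \<and> wconv (\<lambda>k. v (r k)) v'
    \<and> (\<lambda>k. a (r k)) \<longlonglongrightarrow> a' \<and> (\<lambda>k. b (r k)) \<longlonglongrightarrow> b'"
proof -
  obtain r1 u' where 1: "strict_mono r1" "u' \<in> MM" "wconv (\<lambda>k. u (r1 k)) u'"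
    using MM_Helly[of u] assms by blast
  obtain r2 v' where 2: "strict_mono r2" "v' \<in> MM" "wconv (\<lambda>k. v (r1 (r2 k))) v'"
    using MM_Helly[of "\<lambda>k. v (r1 k)"] assms by blast
  obtain r3 a' where 3: "strict_mono r3" "a' \<in> {A..B}" "(\<lambda>k. a (r1 (r2 (r3 k)))) \<longlonglongrightarrow> a'"
    using bounded_subseq[of "\<lambda>k. a (r1 (r2 k))"] assms by blast
  obtain r4 b' where 4: "strict_mono r4" "b' \<in> {A..B}" "(\<lambda>k. b (r1 (r2 (r3 (r4 k))))) \<longlonglongrightarrow> b'"
    using bounded_subseq[of "\<lambda>k. b (r1 (r2 (r3 k)))"] assms by blast
  have r34: "strict_mono (\<lambda>k. r3 (r4 k))" and r234: "strict_mono (\<lambda>k. r2 (r3 (r4 k)))"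
    using 2(1) 3(1) 4(1) by (simp_all add: strict_mono_def)
  then have "strict_mono (\<lambda>k. r1 (r2 (r3 (r4 k))))"
    using 1(1) by (simp add: strict_mono_def)
  moreover have "wconv (\<lambda>k. u (r1 (r2 (r3 (r4 k))))) u'" "wconv (\<lambda>k. v (r1 (r2 (r3 (r4 k))))) v'"
    using wconv_subseq[OF 1(3) r234] wconv_subseq[OF 2(3) r34] by simp_all
  moreover have "(\<lambda>k. a (r1 (r2 (r3 (r4 k))))) \<longlonglongrightarrow> a'"
    using LIMSEQ_subseq_LIMSEQ[OF 3(3) 4(1)] by (simp add: o_def)
  ultimately show ?thesis
    using 1(2) 2(2) 3(2) 4(2,3) by blast
qed

lemma MM_limits:
  assumes "u \<in> MM"
  obtains a b where "(u \<longlongrightarrow> a) at_bot" "(u \<longlongrightarrow> b) at_top" "0 \<le> a" "b \<le> 1" "\<And>x. a \<le> u x" "\<And>x. u x \<le> b"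
proof -
  have bdd: "bdd_below (range u)" "bdd_above (range u)"
    by (rule bdd_belowI2[of _ 0] bdd_aboveI2[of _ _ 1]; rule MM_bounds[OF assms])+
  have le: "Inf (range u) \<le> u x" "u x \<le> Sup (range u)" for x
    using bdd by (auto intro: cInf_lower cSup_upper)
  have "(u \<longlongrightarrow> Inf (range u)) at_bot"
  proof (rule order_tendstoI)
    fix y assume "Inf (range u) < y"
    then obtain x where "u x < y" using cInf_less_iff[OF _ bdd(1)] by auto
    then have "u z < y" if "z \<le> x" for z using MM_mono[OF assms that] by simp
    then show "\<forall>\<^sub>F z in at_bot. u z < y" unfolding eventually_at_bot_linorder by blast
  next
    fix y assume "y < Inf (range u)"
    then have "y < u z" for z using le(1)[of z] by simp
    then show "\<forall>\<^sub>F z in at_bot. y < u z" by simp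
  qed
  moreover have "(u \<longlongrightarrow> Sup (range u)) at_top"
  proof (rule order_tendstoI)
    fix y assume "y < Sup (range u)"
    then obtain x where "y < u x" using less_cSup_iff[OF _ bdd(2)] by auto
    then have "y < u z" if "x \<le> z" for z using MM_mono[OF assms that] by simp
    then show "\<forall>\<^sub>F z in at_top. y < u z" unfolding eventually_at_top_linorder by blast
  next
    fix y assume "Sup (range u) < y"
    then have "u z < y" for z using le(2)[of z] by simp
    then show "\<forall>\<^sub>F z in at_top. u z < y" by simp
  qed
  moreover have "0 \<le> Inf (range u)" "Sup (range u) \<le> 1"
    using MM_bounds[OF assms] by (auto intro: cInf_greatest cSup_least)
  ultimately show thesis using that le by blast
qed

section \<open>Fronts of a single map\<close>

text \<open>Hypotheses (i) to (iii) for a single map, so that every \<open>Q t\<close> with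
  \<open>t > 0\<close> is an instance.\<close>

locale front_map =
  fixes P :: "(real \<Rightarrow> real) \<Rightarrow> real \<Rightarrow> real"
  assumes maps: "u \<in> MM \<Longrightarrow> P u \<in> MM"
    and cont: "u \<in> MM \<Longrightarrow> (\<forall>k. uk k \<in> MM) \<Longrightarrow>
      (\<forall>a b. uniform_limit {a..b} uk u sequentially) \<Longrightarrow>
      AE x in lborel. (\<lambda>k. P (uk k) x) \<longlonglongrightarrow> P u x"
    and order: "u \<in> MM \<Longrightarrow> v \<in> MM \<Longrightarrow> (\<forall>x. u x \<le> v x) \<Longrightarrow> P u x \<le> P v x"
    and shift: "u \<in> MM \<Longrightarrow> P (\<lambda>x. u (x - s)) = (\<lambda>x. P u (x - s))"
begin

lemma shift': "u \<in> MM \<Longrightarrow> P (\<lambda>x. u (x + s)) = (\<lambda>x. P u (x + s))"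
  using shift[of u "- s"] by simp

text \<open>By monotonicity \<open>P (uk k)\<close> lies between the images of the minimum and the
  maximum of \<open>uk k\<close> with translates of \<open>u\<close>. Those converge locally
  uniformly, so (i) applies, and the translation by \<open>h\<close> fits into the gap of
  \<open>wconv\<close>.\<close>

lemma wconv_map:
  assumes w: "wconv uk u" and uk: "\<And>k. uk k \<in> MM" and u: "u \<in> MM"
  shows "wconv (\<lambda>k. P (uk k)) (P u)"
  unfolding wconv_def eventually_conj_iff
proof (intro allI impI conjI)
  fix x y e :: real assume "x < y" "0 < e"
  define h where "h = (y - x) / 2"
  have h: "0 < h" using \<open>x < y\<close> by (simp add: h_def)
  let ?v = "\<lambda>k x. max (uk k x) (u (x + h))"
  have v: "?v k \<in> MM" for k using uk u by (intro MM_max MM_shift')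
  have "AE z in lborel. (\<lambda>k. P (?v k) z) \<longlonglongrightarrow> P (\<lambda>x. u (x + h)) z"
    using v MM_shift'[OF u] uniform_limit_max_shift[OF w uk u h] by (intro cont allI)
  then have ae: "AE z in lborel. (\<lambda>k. P (?v k) z) \<longlonglongrightarrow> P u (z + h)"
    by (simp only: shift'[OF u])
  have "x < x + h" using h by simp
  with ae obtain z where z: "x < z" "z < x + h" "(\<lambda>k. P (?v k) z) \<longlonglongrightarrow> P u (z + h)"
    by (rule AE_interval_witness)
  have "\<forall>\<^sub>F k in sequentially. P (?v k) z < P u (z + h) + e"
    by (rule order_tendstoD(2)[OF z(3)]) (use \<open>0 < e\<close> in simp)
  then show "\<forall>\<^sub>F k in sequentially. P (uk k) x \<le> P u y + e"
  proof eventually_elim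
    case (elim k)
    have "P (uk k) x \<le> P (uk k) z" by (rule MM_mono[OF maps[OF uk]]) (use z in simp)
    also have "\<dots> \<le> P (?v k) z" using uk v by (intro order allI; simp)
    finally have *: "P (uk k) x \<le> P (?v k) z" .
    have "P u (z + h) \<le> P u (y)"
      by (rule MM_mono[OF maps[OF u]]) (use z in \<open>simp add: h_def field_simps\<close>)
    then show ?case using elim * by linarith
  qed
next
  fix x y e :: real assume "x < y" "0 < e"
  define h where "h = (y - x) / 2"
  have h: "0 < h" using \<open>x < y\<close> by (simp add: h_def)
  let ?v = "\<lambda>k x. min (uk k x) (u (x - h))"
  have v: "?v k \<in> MM" for k using uk u by (intro MM_min MM_shift)
  have "AE z in lborel. (\<lambda>k. P (?v k) z) \<longlonglongrightarrow> P (\<lambda>x. u (x - h)) z"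
    using v MM_shift[OF u] uniform_limit_min_shift[OF w uk u h] by (intro cont allI)
  then have ae: "AE z in lborel. (\<lambda>k. P (?v k) z) \<longlonglongrightarrow> P u (z - h)"
    by (simp only: shift[OF u])
  have "y - h < y" using h by simp
  with ae obtain z where z: "y - h < z" "z < y" "(\<lambda>k. P (?v k) z) \<longlonglongrightarrow> P u (z - h)"
    by (rule AE_interval_witness)
  have "\<forall>\<^sub>F k in sequentially. P u (z - h) - e < P (?v k) z"
    by (rule order_tendstoD(1)[OF z(3)]) (use \<open>0 < e\<close> in simp)
  then show "\<forall>\<^sub>F k in sequentially. P u x \<le> P (uk k) y + e"
  proof eventually_elim
    case (elim k)
    have "P (?v k) z \<le> P (uk k) z" using uk v by (intro order allI; simp)
    also have "\<dots> \<le> P (uk k) y" by (rule MM_mono[OF maps[OF uk]]) (use z in simp)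
    finally have *: "P (?v k) z \<le> P (uk k) y" .
    have "P u (x) \<le> P u (z - h)"
      by (rule MM_mono[OF maps[OF u]]) (use z in \<open>simp add: h_def field_simps\<close>)
    then show ?case using elim * by linarith
  qed
qed

text \<open>Both sides of the wave equation converge weakly, and weak limits are unique. The
  equation is required only eventually because a fixed dyadic time is a multiple of the time step
  only from some index on.\<close>

lemma wave_limit:
  assumes w: "wconv wk w" and wk: "\<And>k. wk k \<in> MM" "w \<in> MM"
    and wave: "\<forall>\<^sub>F k in sequentially. \<forall>x. wk k x = P (wk k) (x - d k x)"
    and d: "\<And>x. (\<lambda>k. d k x) \<longlonglongrightarrow> c"
  shows "w x = P w (x - c)"
proof -
  have lim: "wconv (\<lambda>k x. P (wk k) (x - d k x)) (\<lambda>x. P w (x - c))"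
    by (intro wconv_moving_shift wconv_map w wk maps d)
  have "wconv wk (\<lambda>x. P w (x - c))"
    unfolding wconv_def
  proof (intro allI impI)
    fix x y e :: real assume "x < y" "0 < e"
    with lim have "\<forall>\<^sub>F k in sequentially. P (wk k) (x - d k x) \<le> P w (y - c) + e \<and>
        P w (x - c) \<le> P (wk k) (y - d k y) + e"
      unfolding wconv_def by blast
    with wave show "\<forall>\<^sub>F k in sequentially. wk k x \<le> P w (y - c) + e \<and> P w (x - c) \<le> wk k y + e"
      by eventually_elim metis
  qed
  then have "w = (\<lambda>x. P w (x - c))"
    using w wk by (intro wconv_unique MM_shift maps)
  from fun_cong[OF this, of x] show ?thesis .
qed

text \<open>Translates of a wave are waves with the same displacement; sliding them along
  \<open>s\<close> leaves a constant wave in the limit.\<close>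

lemma wave_end_state:
  assumes W: "W \<in> MM" "\<And>x. W x = P W (x - c)" and s: "\<And>x. (\<lambda>k. W (x + s k)) \<longlonglongrightarrow> \<beta>"
    and \<beta>: "0 \<le> \<beta>" "\<beta> \<le> 1"
  shows "P (\<lambda>_. \<beta>) = (\<lambda>_. \<beta>)"
proof
  fix x
  have "wconv (\<lambda>k x. W (x + s k)) (\<lambda>_. \<beta>)"
    by (rule wconv_AE) (simp_all add: MM_shift'[OF W(1)] MM_const \<beta> s)
  \<comment> \<open>Evaluation at \<open>x + c\<close> cancels the displacement.\<close>
  then have "\<beta> = P (\<lambda>_. \<beta>) (x + c - c)"
  proof (rule wave_limit[where d = "\<lambda>_ _. c"])
    have "W (x + s k) = P (\<lambda>x. W (x + s k)) (x - c)" for k x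
      unfolding shift'[OF W(1)] by (subst W(2)) (simp add: algebra_simps)
    then show "\<forall>\<^sub>F k in sequentially. \<forall>x. W (x + s k) = P (\<lambda>x. W (x + s k)) (x - c)"
      by (intro always_eventually allI)
  qed (simp_all add: MM_shift'[OF W(1)] MM_const \<beta>)
  then show "P (\<lambda>_. \<beta>) x = \<beta>" by simp
qed

text \<open>The translate of \<open>l\<close> vanishes up to \<open>R\<close>, and beyond
  \<open>R\<close> the displacement is exactly \<open>cl\<close>, so it is a lower solution.
  Symmetrically the translate of \<open>v\<close> equals 1 from \<open>- R\<close> on, and to the
  left of \<open>- R\<close> the displacement is \<open>cu\<close>.\<close>

lemma tapered_front:
  assumes l: "l \<in> MM" "l 0 = 0" "\<And>x. l x \<le> P l (x - cl)"
    and v: "v \<in> MM" "v 0 = 1" "\<And>x. P v (x - cu) \<le> v x"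
    and c: "cl \<le> cu" and e: "0 < e"
  shows "\<exists>U R. U \<in> MM \<and> (\<forall>x. U x = P U (x - clip cl cu (- e * x))) \<and>
    (\<forall>x. l (x - R) \<le> U x) \<and> (\<forall>x. U x \<le> v (x + R))"
proof -
  \<comment> \<open>For \<open>\<bar>x\<bar> \<ge> R\<close> the size of \<open>e * x\<close> is at
    least that of \<open>cl\<close> and of \<open>cu\<close>, so \<open>clip\<close> has reached one
    of its bounds.\<close>
  define R where "R = (\<bar>cl\<bar> + \<bar>cu\<bar>) / e"
  have R: "0 \<le> R" "e * R = \<bar>cl\<bar> + \<bar>cu\<bar>" using e by (simp_all add: R_def)
  define g where "g x = x - clip cl cu (- e * x)" for x
  have g_right: "g x = x - cl" if "R \<le> x" for x
  proof -
    have "e * R \<le> e * x" using e that by simp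
    then show ?thesis using R by (simp add: g_def clip_def)
  qed
  have g_left: "g x = x - cu" if "x \<le> - R" for x
  proof -
    have "e * x \<le> e * (- R)" using e that by (intro mult_left_mono) simp_all
    then show ?thesis using R c by (simp add: g_def clip_def)
  qed
  \<comment> \<open>A displacement that decreases in \<open>x\<close> makes \<open>g\<close>
    strictly increasing, so that composition with \<open>g\<close> stays in
    \<open>MM\<close>.\<close>
  have "strict_mono g"
  proof
    fix x y :: real assume "x < y"
    then have "clip cl cu (- e * y) \<le> clip cl cu (- e * x)" using e by (intro clip_mono) simp
    then show "g x < g y" using \<open>x < y\<close> by (simp add: g_def)
  qed
  moreover have "continuous_on UNIV g"
    unfolding g_def clip_def by (intro continuous_intros)
  ultimately have maps_g: "(\<lambda>x. P u (g x)) \<in> MM" if "u \<in> MM" for u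
    by (rule MM_comp[OF maps[OF that]])
  define T where "T u = (\<lambda>x. P u (g x))" for u
  have l_neg: "l x = 0" if "x \<le> 0" for x
    using MM_mono[OF l(1) that] MM_bounds(1)[OF l(1), of x] l(2) by simp
  have v_pos: "v x = 1" if "0 \<le> x" for x
    using MM_mono[OF v(1) that] MM_bounds(2)[OF v(1), of x] v(2) by simp
  have "\<exists>U\<in>MM. T U = U \<and> (\<lambda>x. l (x - R)) \<le> U \<and> U \<le> (\<lambda>x. v (x + R))"
  proof (rule MM_fixed_point)
    show "T u \<in> MM" if "u \<in> MM" for u using maps_g that by (simp add: T_def)
    show "T u \<le> T w" if "u \<in> MM" "w \<in> MM" "u \<le> w" for u w
      using that by (auto simp: T_def le_fun_def intro: order)
    show "(\<lambda>x. l (x - R)) \<in> MM" "(\<lambda>x. v (x + R)) \<in> MM"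
      using l v by (simp_all add: MM_shift MM_shift')
    show "(\<lambda>x. l (x - R)) \<le> T (\<lambda>x. l (x - R))"
    proof (rule le_funI)
      fix x
      show "l (x - R) \<le> T (\<lambda>x. l (x - R)) x"
      proof (cases "x \<le> R")
        case True
        then show ?thesis using l_neg MM_bounds(1)[OF maps[OF l(1)]] by (simp add: T_def shift l)
      next
        case False
        then show ?thesis using l(3)[of "x - R"] by (simp add: T_def shift l g_right algebra_simps)
      qed
    qed
    show "T (\<lambda>x. v (x + R)) \<le> (\<lambda>x. v (x + R))"
    proof (rule le_funI)
      fix x
      show "T (\<lambda>x. v (x + R)) x \<le> v (x + R)"
      proof (cases "- R \<le> x")
        case True
        then show ?thesis using v_pos MM_bounds(2)[OF maps[OF v(1)]] by (simp add: T_def shift' v)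
      next
        case False
        then show ?thesis using v(3)[of "x + R"] by (simp add: T_def shift' v g_left algebra_simps)
      qed
    qed
    show "(\<lambda>x. l (x - R)) \<le> (\<lambda>x. v (x + R))"
    proof (rule le_funI)
      fix x
      show "l (x - R) \<le> v (x + R)"
      proof (cases "x \<le> R")
        case True
        then show ?thesis using l_neg MM_bounds(1)[OF v(1)] by simp
      next
        case False
        then show ?thesis using v_pos R MM_bounds(2)[OF l(1)] by simp
      qed
    qed
  qed
  then obtain U where "U \<in> MM" "T U = U" "(\<lambda>x. l (x - R)) \<le> U" "U \<le> (\<lambda>x. v (x + R))" by blast
  then show ?thesis
    by (intro exI[of _ U] exI[of _ R]) (metis T_def g_def le_funD)
qed

text \<open>For a small slope the displacement is almost constant around each crossing point, so the
  limits are genuine waves. The lower level is crossed first and the displacement decreases to the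
  right, whence \<open>cp \<le> cm\<close>.\<close>

lemma wave_pair:
  assumes l: "l \<in> MM" "l 0 = 0" "\<And>x. l x \<le> P l (x - cl)"
    and v: "v \<in> MM" "v 0 = 1" "\<And>x. P v (x - cu) \<le> v x"
    and c: "cl \<le> cu" and lev: "v p < lm" "lm < lp" "lp < l q"
  shows "\<exists>cm cp wm wp. cl \<le> cp \<and> cp \<le> cm \<and> cm \<le> cu \<and> wm \<in> MM \<and> wp \<in> MM \<and>
    crosses wm lm \<and> crosses wp lp \<and>
    (\<forall>x. wm x = P wm (x - cm)) \<and> (\<forall>x. wp x = P wp (x - cp))"
proof -
  have tapered: "\<exists>U ym yp. U \<in> MM \<and> (\<forall>x. U x = P U (x - clip cl cu (- e * x))) \<and> ym \<le> yp \<and>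
      crosses (\<lambda>x. U (x + ym)) lm \<and> crosses (\<lambda>x. U (x + yp)) lp" if e: "0 < e" for e
  proof -
    obtain U R where U: "U \<in> MM" "\<forall>x. U x = P U (x - clip cl cu (- e * x))"
      "\<forall>x. l (x - R) \<le> U x" "\<forall>x. U x \<le> v (x + R)"
      using tapered_front[OF l v c e] by blast
    have p: "U (p - R) < lm" and q: "lp < U (q + R)"
      using lev U(4)[rule_format, of "p - R"] U(3)[rule_format, of "q + R"] by simp_all
    obtain ym where ym: "crosses (\<lambda>x. U (x + ym)) lm"
      using crosses_exists[OF U(1) p less_trans[OF lev(2) q]] by blast
    obtain yp where yp: "crosses (\<lambda>x. U (x + yp)) lp"
      using crosses_exists[OF U(1) less_trans[OF p lev(2)] q] by blast
    \<comment> \<open>Otherwise the midpoint of \<open>yp\<close> and \<open>ym\<close> lies left of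
      the crossing of \<open>lm\<close> and right of that of \<open>lp\<close>, forcing
      \<open>lp \<le> lm\<close>.\<close>
    have "ym \<le> yp"
    proof (rule ccontr)
      assume "\<not> ym \<le> yp"
      then have "U ((yp - ym) / 2 + ym) \<le> lm" "lp \<le> U ((ym - yp) / 2 + yp)"
        using ym yp unfolding crosses_def by auto
      moreover have "(yp - ym) / 2 + ym = (ym - yp) / 2 + yp" by (simp add: field_simps)
      ultimately show False using lev by simp
    qed
    then show ?thesis using U ym yp by blast
  qed
  have "\<forall>k::nat. \<exists>U ym yp. U \<in> MM \<and>
      (\<forall>x. U x = P U (x - clip cl cu (- (1 / real (Suc k)) * x))) \<and> ym \<le> yp \<and>
      crosses (\<lambda>x. U (x + ym)) lm \<and> crosses (\<lambda>x. U (x + yp)) lp"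
    by (intro allI tapered) simp
  then obtain U ym yp where U: "\<And>k. U k \<in> MM"
    "\<And>k x. U k x = P (U k) (x - clip cl cu (- (1 / real (Suc k)) * x))" "\<And>k. ym k \<le> yp k"
    "\<And>k. crosses (\<lambda>x. U k (x + ym k)) lm" "\<And>k. crosses (\<lambda>x. U k (x + yp k)) lp"
    by metis
  define s where "s k x = clip cl cu (- (1 / real (Suc k)) * x)" for k x
  have s_in: "s k x \<in> {cl..cu}" for k x
    using clip_bounds[OF c] by (simp add: s_def)
  obtain r wm wp cm cp where r: "strict_mono r" and wm: "wm \<in> MM" "wconv (\<lambda>k x. U (r k) (x + ym (r k))) wm"
    and wp: "wp \<in> MM" "wconv (\<lambda>k x. U (r k) (x + yp (r k))) wp"
    and cm: "cm \<in> {cl..cu}" "(\<lambda>k. s (r k) (ym (r k))) \<longlonglongrightarrow> cm"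
    and cp: "cp \<in> {cl..cu}" "(\<lambda>k. s (r k) (yp (r k))) \<longlonglongrightarrow> cp"
    using wave_data_subseq[of "\<lambda>k x. U k (x + ym k)" "\<lambda>k x. U k (x + yp k)"
        "\<lambda>k. s k (ym k)" cl cu "\<lambda>k. s k (yp k)"] U(1) s_in MM_shift' by blast
  \<comment> \<open>\<open>clip\<close> is 1-Lipschitz, so the displacements at
    \<open>x + y k\<close> and at the centre \<open>y k\<close> differ by at most
    \<open>\<bar>x\<bar> / Suc k\<close>, even if the centres run off to infinity.\<close>
  have freeze: "w x = P w (x - c)"
    if w: "w \<in> MM" "wconv (\<lambda>k x. U (r k) (x + y (r k))) w"
      and lim: "(\<lambda>k. s (r k) (y (r k))) \<longlonglongrightarrow> c" for w y c x
  proof (rule wave_limit[OF w(2)])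
    have "U k (x + y k) = P (\<lambda>x. U k (x + y k)) (x - s k (x + y k))" for k x
      unfolding shift'[OF U(1)] s_def by (subst U(2)) (simp add: algebra_simps)
    then show "\<forall>\<^sub>F k in sequentially. \<forall>x. U (r k) (x + y (r k)) =
        P (\<lambda>x. U (r k) (x + y (r k))) (x - s (r k) (x + y (r k)))"
      by (intro always_eventually allI)
    fix x
    have "\<bar>s k (x + y k) - s k (y k)\<bar> \<le> \<bar>x\<bar> * (1 / real (Suc k))" for k
    proof -
      have "\<bar>s k (x + y k) - s k (y k)\<bar> \<le> \<bar>- (1 / real (Suc k)) * (x + y k) - - (1 / real (Suc k)) * y k\<bar>"
        unfolding s_def by (rule clip_dist)
      also have "- i * (x + y k) - - i * y k = - (x * i)" for i
        by (simp add: algebra_simps)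
      finally show ?thesis by (simp add: abs_mult)
    qed
    then have bound: "\<forall>k. norm (s (r k) (x + y (r k)) - s (r k) (y (r k))) \<le> \<bar>x\<bar> * (1 / real (Suc (r k)))"
      by simp
    have to_0: "(\<lambda>k. \<bar>x\<bar> * (1 / real (Suc k))) \<longlonglongrightarrow> 0"
      using tendsto_mult_right_zero[OF LIMSEQ_inverse_real_of_nat, of "\<bar>x\<bar>"] by (simp add: inverse_eq_divide)
    have "(\<lambda>k. \<bar>x\<bar> * (1 / real (Suc (r k)))) \<longlonglongrightarrow> 0"
      using LIMSEQ_subseq_LIMSEQ[OF to_0 r] by (simp add: o_def)
    then have "(\<lambda>k. s (r k) (x + y (r k)) - s (r k) (y (r k))) \<longlonglongrightarrow> 0"
      by (rule Lim_null_comparison[OF always_eventually[OF bound]])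
    from tendsto_add[OF this lim] show "(\<lambda>k. s (r k) (x + y (r k))) \<longlonglongrightarrow> c" by simp
  qed (simp_all add: w(1) U(1) MM_shift')
  have "s k (yp k) \<le> s k (ym k)" for k
    unfolding s_def using U(3)[of k] by (intro clip_mono) (simp add: divide_right_mono)
  then have "cp \<le> cm"
    using LIMSEQ_le[OF cp(2) cm(2)] by blast
  moreover have "crosses wm lm" "crosses wp lp"
    by (rule crosses_wconv[OF wm(2)] crosses_wconv[OF wp(2)]; use U in blast)+
  moreover have "\<forall>x. wm x = P wm (x - cm)" "\<forall>x. wp x = P wp (x - cp)"
    by (intro allI freeze[OF wm cm(2)] freeze[OF wp cp(2)])+
  moreover have "cl \<le> cp" "cm \<le> cu" using cm(1) cp(1) by simp_all
  ultimately show ?thesis using wm(1) wp(1) by blast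
qed

end

section \<open>Fronts of the semigroup\<close>

theorem theorem8:
  fixes \<alpha> :: real and Q :: "real \<Rightarrow> (real \<Rightarrow> real) \<Rightarrow> (real \<Rightarrow> real)"
    and cl cu :: real and psil psiu :: "real \<Rightarrow> real"
  assumes alpha: "0 < \<alpha>" "\<alpha> < 1"
    and QM: "\<And>t u. t \<ge> 0 \<Longrightarrow> u \<in> MM \<Longrightarrow> Q t u \<in> MM"
    and Qi: "\<And>t u uk. t > 0 \<Longrightarrow> u \<in> MM \<Longrightarrow> (\<forall>k. uk k \<in> MM) \<Longrightarrow>
              (\<forall>a b. uniform_limit {a..b} uk u sequentially) \<Longrightarrow>
              AE x in lborel. (\<lambda>k. Q t (uk k) x) \<longlonglongrightarrow> Q t u x"
    and Qii: "\<And>t u1 u2. t > 0 \<Longrightarrow> u1 \<in> MM \<Longrightarrow> u2 \<in> MM \<Longrightarrow> (\<forall>x. u1 x \<le> u2 x) \<Longrightarrow>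
              (\<forall>x. Q t u1 x \<le> Q t u2 x)"
    and Qiii: "\<And>t u x0. t > 0 \<Longrightarrow> u \<in> MM \<Longrightarrow>
              Q t (\<lambda>x. u (x - x0)) = (\<lambda>x. Q t u (x - x0))"
    and Qiv1: "\<And>t. t > 0 \<Longrightarrow> Q t (\<lambda>_. \<alpha>) = (\<lambda>_. \<alpha>)"
    and Qiv2: "\<And>t \<gamma>. t > 0 \<Longrightarrow> 0 < \<gamma> \<Longrightarrow> \<gamma> < \<alpha> \<Longrightarrow> (\<forall>x. Q t (\<lambda>_. \<gamma>) x < \<gamma>)"
    and Qiv3: "\<And>t \<gamma>. t > 0 \<Longrightarrow> \<alpha> < \<gamma> \<Longrightarrow> \<gamma> < 1 \<Longrightarrow> (\<forall>x. \<gamma> < Q t (\<lambda>_. \<gamma>) x)"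
    and Qa: "\<And>t s u. t \<ge> 0 \<Longrightarrow> s \<ge> 0 \<Longrightarrow> u \<in> MM \<Longrightarrow> Q t (Q s u) = Q (t + s) u"
    and Qb: "\<And>tk u. (\<forall>k. tk k \<ge> 0) \<Longrightarrow> tk \<longlonglongrightarrow> 0 \<Longrightarrow> u \<in> MM \<Longrightarrow>
              AE x in lborel. (\<lambda>k. Q (tk k) u x) \<longlonglongrightarrow> u x"
    and Qc: "\<And>cm cp phim phip. phim \<in> MM \<Longrightarrow> phip \<in> MM \<Longrightarrow>
              (phim \<longlongrightarrow> 0) at_bot \<Longrightarrow> (phim \<longlongrightarrow> \<alpha>) at_top \<Longrightarrow>
              (phip \<longlongrightarrow> \<alpha>) at_bot \<Longrightarrow> (phip \<longlongrightarrow> 1) at_top \<Longrightarrow>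
              (\<forall>t\<ge>0. \<forall>x. Q t phim (x - cm * t) = phim x) \<Longrightarrow>
              (\<forall>t\<ge>0. \<forall>x. Q t phip (x - cp * t) = phip x) \<Longrightarrow> cm < cp"
    and psil: "psil \<in> MM" "psil 0 = 0"
      "\<exists>L. (psil \<longlongrightarrow> L) at_top \<and> \<alpha> < L \<and> L \<le> 1"
      "\<forall>t\<ge>0. \<forall>x. psil x \<le> Q t psil (x - cl * t)"
    and psiu: "psiu \<in> MM" "psiu 0 = 1"
      "\<exists>L. (psiu \<longlongrightarrow> L) at_bot \<and> 0 \<le> L \<and> L < \<alpha>"
      "\<forall>t\<ge>0. \<forall>x. Q t psiu (x - cu * t) \<le> psiu x"
  shows "\<exists>c phi. cl \<le> c \<and> c \<le> cu \<and> phi \<in> MM \<and>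
           (phi \<longlongrightarrow> 0) at_bot \<and> (phi \<longlongrightarrow> 1) at_top \<and>
           (\<forall>t\<ge>0. \<forall>x. Q t phi (x - c * t) = phi x)"
proof -

  \<comment> \<open>Time zero, the two levels and the order of the given speeds\<close>
  have FM: "front_map (Q t)" if "0 < t" for t
    using that QM[of t] Qi[of t] Qii[of t] Qiii[of t] by unfold_locales auto
  \<comment> \<open>Hypothesis (b) for the zero sequence makes \<open>u\<close> the weak limit of
    the constant sequence \<open>Q 0 u\<close>.\<close>
  have Q0: "Q 0 u = u" if "u \<in> MM" for u
  proof -
    have "AE x in lborel. (\<lambda>k::nat. Q 0 u x) \<longlonglongrightarrow> u x"
      using that by (intro Qb[of "\<lambda>_. 0"]) auto
    then have "wconv (\<lambda>_. Q 0 u) u"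
      using that QM by (intro wconv_AE) auto
    then show ?thesis
      using that QM by (intro wconv_unique[of "\<lambda>_. Q 0 u"] wconv_const) auto
  qed
  have Qshift: "Q t (\<lambda>x. u (x + s)) = (\<lambda>x. Q t u (x + s))" if "0 \<le> t" "u \<in> MM" for t u s
  proof (cases "t = 0")
    case True
    then show ?thesis using that by (simp add: Q0 MM_shift')
  next
    case False
    then show ?thesis using that by (intro front_map.shift' FM) auto
  qed
  obtain Ll where Ll: "(psil \<longlongrightarrow> Ll) at_top" "\<alpha> < Ll" "Ll \<le> 1" using psil(3) by blast
  obtain Lu where Lu: "(psiu \<longlongrightarrow> Lu) at_bot" "0 \<le> Lu" "Lu < \<alpha>" using psiu(3) by blast
  \<comment> \<open>The levels avoid the states 0, \<alpha> and 1; \<open>psiu\<close> drops below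
    \<open>lm\<close> and \<open>psil\<close> rises above \<open>lp\<close>.\<close>
  define lm lp where "lm = (Lu + \<alpha>) / 2" and "lp = (\<alpha> + Ll) / 2"
  have lev: "0 < lm" "lm < \<alpha>" "\<alpha> < lp" "lp < 1" "Lu < lm" "lp < Ll"
    using alpha Ll Lu by (simp_all add: lm_def lp_def)
  obtain q where q: "lp < psil q"
    using order_tendstoD(1)[OF Ll(1) lev(6)] by (auto simp: eventually_at_top_linorder)
  obtain p where p: "psiu p < lm"
    using order_tendstoD(2)[OF Lu(1) lev(5)] by (auto simp: eventually_at_bot_linorder)
  have psi_le: "psil x \<le> psiu x" for x
  proof (cases "x \<le> 0")
    case True
    then show ?thesis
      using MM_mono[OF psil(1) True] psil(2) MM_bounds(1)[OF psiu(1), of x] by simp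
  next
    case False
    then show ?thesis
      using MM_mono[OF psiu(1), of 0 x] psiu(2) MM_bounds(2)[OF psil(1), of x] by simp
  qed
  \<comment> \<open>If \<open>cl > cu\<close>, the order of \<open>psil\<close> and
    \<open>psiu\<close> breaks in time: \<open>t\<close> is chosen so that the relative displacement
    carries \<open>q\<close> to the left of \<open>p\<close>, giving
    \<open>psil q \<le> psiu p\<close>.\<close>
  have c_le: "cl \<le> cu"
  proof (rule ccontr)
    assume "\<not> cl \<le> cu"
    define t where "t = (\<bar>q - p\<bar> + 1) / (cl - cu)"
    have t: "0 < t" "(cl - cu) * t = \<bar>q - p\<bar> + 1"
      using \<open>\<not> cl \<le> cu\<close> by (simp_all add: t_def)
    have "psil q \<le> Q t psil (q - cl * t)" using psil(4) t by simp
    also have "\<dots> \<le> Q t psiu (q - cl * t)" using Qii psil(1) psiu(1) psi_le t by blast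
    also have "\<dots> = Q t psiu ((q - (cl - cu) * t) - cu * t)" by (simp add: algebra_simps)
    also have "\<dots> \<le> psiu (q - (cl - cu) * t)" using psiu(4) t(1) by simp
    also have "\<dots> \<le> psiu p" by (rule MM_mono[OF psiu(1)]) (simp add: t(2))
    finally show False using p q lev by simp
  qed

  \<comment> \<open>Pairs of waves for dyadic time steps and their limit\<close>
  define \<tau> :: "nat \<Rightarrow> real" where "\<tau> n = 1 / 2 ^ n" for n
  have \<tau>: "0 < \<tau> n" for n by (simp add: \<tau>_def)
  have "\<exists>cm cp wm wp. cl \<le> cp \<and> cp \<le> cm \<and> cm \<le> cu \<and> wm \<in> MM \<and> wp \<in> MM \<and>
    crosses wm lm \<and> crosses wp lp \<and> (\<forall>x. wm x = Q (\<tau> n) wm (x - cm * \<tau> n)) \<and>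
    (\<forall>x. wp x = Q (\<tau> n) wp (x - cp * \<tau> n))" for n
  proof -
    obtain cm cp wm wp where w: "cl * \<tau> n \<le> cp" "cp \<le> cm" "cm \<le> cu * \<tau> n" "wm \<in> MM" "wp \<in> MM"
      "crosses wm lm" "crosses wp lp"
      "\<forall>x. wm x = Q (\<tau> n) wm (x - cm)" "\<forall>x. wp x = Q (\<tau> n) wp (x - cp)"
      using front_map.wave_pair[OF FM[OF \<tau>[of n]] psil(1,2) _ psiu(1,2) _ _ p _ q,
          of "cl * \<tau> n" "cu * \<tau> n"]
        psil(4) psiu(4) c_le \<tau>[of n] lev by auto
    \<comment> \<open>\<open>wave_pair\<close> yields displacements per step; division by the step
      length turns them into speeds.\<close>
    have "cl \<le> cp / \<tau> n" "cp / \<tau> n \<le> cm / \<tau> n" "cm / \<tau> n \<le> cu"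
      using w(1,2,3) \<tau>[of n] by (simp_all add: field_simps)
    moreover have "cm / \<tau> n * \<tau> n = cm" "cp / \<tau> n * \<tau> n = cp" using \<tau>[of n] by simp_all
    ultimately show ?thesis
      using w(4-) by (intro exI[of _ "cm / \<tau> n"] exI[of _ "cp / \<tau> n"] exI[of _ wm] exI[of _ wp]) simp
  qed
  then obtain cm cp wm wp where w: "\<And>n. cl \<le> cp n" "\<And>n. cp n \<le> cm n" "\<And>n. cm n \<le> cu"
    "\<And>n. wm n \<in> MM" "\<And>n. wp n \<in> MM" "\<And>n. crosses (wm n) lm" "\<And>n. crosses (wp n) lp"
    and wave_m: "\<And>n x. wm n x = Q (\<tau> n) (wm n) (x - cm n * \<tau> n)"
    and wave_p: "\<And>n x. wp n x = Q (\<tau> n) (wp n) (x - cp n * \<tau> n)"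
    by metis
  have c_in: "cm n \<in> {cl..cu}" "cp n \<in> {cl..cu}" for n
    using w(1,2,3)[of n] by auto
  obtain r Wm Wp Cm Cp where r: "strict_mono r"
    and W: "Wm \<in> MM" "Wp \<in> MM" "wconv (\<lambda>k. wm (r k)) Wm" "wconv (\<lambda>k. wp (r k)) Wp"
    and C: "Cm \<in> {cl..cu}" "Cp \<in> {cl..cu}" "(\<lambda>k. cm (r k)) \<longlonglongrightarrow> Cm" "(\<lambda>k. cp (r k)) \<longlonglongrightarrow> Cp"
    using wave_data_subseq[of wm wp cm cl cu cp, OF w(4,5) c_in] by blast

  \<comment> \<open>From single steps to dyadic times and then to all times\<close>
  have iterate: "Q (real m * t) u = (\<lambda>x. u (x + c * (real m * t)))"
    if u: "u \<in> MM" and t: "0 < t" and wave: "\<And>x. u x = Q t u (x - c * t)" for u c t m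
  proof (induction m)
    case 0
    then show ?case using u by (simp add: Q0)
  next
    case (Suc m)
    have Qt: "Q t u = (\<lambda>x. u (x + c * t))"
    proof
      fix x show "Q t u x = u (x + c * t)" by (subst wave) simp
    qed
    have "Q (real (Suc m) * t) u = Q (t + real m * t) u" by (simp add: algebra_simps)
    also have "\<dots> = Q t (Q (real m * t) u)" using u t by (intro Qa[symmetric]) auto
    also have "\<dots> = (\<lambda>x. Q t u (x + c * (real m * t)))"
      unfolding Suc.IH using u t by (intro Qshift) auto
    also have "\<dots> = (\<lambda>x. u (x + c * (real (Suc m) * t)))"
      unfolding Qt by (simp add: algebra_simps)
    finally show ?case .
  qed
  \<comment> \<open>For \<open>k \<ge> N\<close> the time \<open>m / 2 ^ N\<close> is an integer
    multiple of the step \<open>\<tau> (r k)\<close>, so the approximating waves satisfy the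
    equation at that time exactly, and \<open>wave_limit\<close> applies with the time
    fixed.\<close>
  have dyadic: "Q (real m / 2 ^ N) V = (\<lambda>x. V (x + c * (real m / 2 ^ N)))"
    if v: "\<And>n. v n \<in> MM" "V \<in> MM" "wconv (\<lambda>k. v (r k)) V"
      and wave: "\<And>n x. v n x = Q (\<tau> n) (v n) (x - b n * \<tau> n)" and b: "(\<lambda>k. b (r k)) \<longlonglongrightarrow> c"
    for v V b c m N
  proof (cases "m = 0")
    case True
    then show ?thesis using v by (simp add: Q0)
  next
    case False
    define t where "t = real m / 2 ^ N"
    have t: "0 < t" using False by (simp add: t_def)
    have "V x = Q t V (x - c * t)" for x
    proof (rule front_map.wave_limit[OF FM[OF t] v(3)])
      have "v (r k) x = Q t (v (r k)) (x - b (r k) * t)" if "N \<le> k" for k x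
      proof -
        have "N \<le> r k" using seq_suble[OF r, of k] that by simp
        then have "real (m * 2 ^ (r k - N)) * \<tau> (r k) = t"
          by (simp add: t_def \<tau>_def field_simps flip: power_add)
        then have "Q t (v (r k)) = (\<lambda>x. v (r k) (x + b (r k) * t))"
          using iterate[OF v(1) \<tau> wave, of "m * 2 ^ (r k - N)" "r k"] by simp
        then show ?thesis by simp
      qed
      then show "\<forall>\<^sub>F k in sequentially. \<forall>x. v (r k) x = Q t (v (r k)) (x - b (r k) * t)"
        unfolding eventually_sequentially by blast
      show "(\<lambda>k. b (r k) * t) \<longlonglongrightarrow> c * t" by (intro tendsto_intros b)
    qed (use v in auto)
    then have "Q t V x = V (x + c * t)" for x by (metis add_diff_cancel_right')
    then show ?thesis unfolding t_def[symmetric] by blast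
  qed
  \<comment> \<open>Round \<open>t\<close> down to the dyadic time \<open>d N\<close>. Up to
    \<open>d N\<close> the wave merely translates; the remaining time tends to 0, where (b) gives
    convergence.\<close>
  have full: "Q t V (x - c * t) = V x"
    if V: "V \<in> MM" and dy: "\<And>m N. Q (real m / 2 ^ N) V = (\<lambda>x. V (x + c * (real m / 2 ^ N)))"
      and t: "0 \<le> t" for V c t x
  proof -
    define d where "d N = real (nat \<lfloor>t * 2 ^ N\<rfloor>) / 2 ^ N" for N
    have d: "0 \<le> d N" "d N \<le> t" "t - d N \<le> (1/2) ^ N" for N
    proof -
      show "0 \<le> d N" by (simp add: d_def)
      have "real (nat \<lfloor>t * 2 ^ N\<rfloor>) \<le> t * 2 ^ N" using t by simp
      then show "d N \<le> t" by (simp add: d_def divide_le_eq)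
      have "t * 2 ^ N - real (nat \<lfloor>t * 2 ^ N\<rfloor>) \<le> 1" using t by linarith
      then have "(t * 2 ^ N - real (nat \<lfloor>t * 2 ^ N\<rfloor>)) / 2 ^ N \<le> 1 / 2 ^ N"
        by (rule divide_right_mono) simp
      then show "t - d N \<le> (1/2) ^ N" by (simp add: d_def diff_divide_distrib power_divide)
    qed
    have lim: "(\<lambda>N. t - d N) \<longlonglongrightarrow> 0"
    proof (rule Lim_null_comparison)
      show "\<forall>\<^sub>F N in sequentially. norm (t - d N) \<le> (1/2) ^ N" using d by simp
      show "(\<lambda>N. (1/2) ^ N :: real) \<longlonglongrightarrow> 0" by (rule LIMSEQ_power_zero) simp
    qed
    have "AE x in lborel. (\<lambda>N. Q (t - d N) V x) \<longlonglongrightarrow> V x"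
      using d lim V by (intro Qb) auto
    then have "wconv (\<lambda>N. Q (t - d N) V) V"
      using V d QM by (intro wconv_AE) auto
    moreover have "(\<lambda>N. - (c * d N)) \<longlonglongrightarrow> - (c * t)"
      using tendsto_diff[OF tendsto_const[of t] lim] by (intro tendsto_intros) simp
    ultimately have "wconv (\<lambda>N x. Q (t - d N) V (x - - (c * d N))) (\<lambda>x. V (x - - (c * t)))"
      using V d QM by (intro wconv_moving_shift) auto
    \<comment> \<open>By the semigroup law the translated functions are all equal to
      \<open>Q t V\<close>, so the weakly convergent sequence is constant.\<close>
    moreover have "(\<lambda>x. Q (t - d N) V (x - - (c * d N))) = Q t V" for N
    proof -
      have "Q t V = Q (t - d N) (Q (d N) V)"
        using Qa[of "t - d N" "d N" V] d V by simp
      also have "Q (d N) V = (\<lambda>x. V (x + c * d N))" unfolding d_def by (rule dy)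
      also have "Q (t - d N) (\<lambda>x. V (x + c * d N)) = (\<lambda>x. Q (t - d N) V (x + c * d N))"
        using d V by (intro Qshift) auto
      finally show ?thesis by simp
    qed
    ultimately have "wconv (\<lambda>_. Q t V) (\<lambda>x. V (x - - (c * t)))" by simp
    then have "Q t V = (\<lambda>x. V (x - - (c * t)))"
      using V t QM MM_shift' by (intro wconv_unique[OF wconv_const]) auto
    then show ?thesis by simp
  qed
  have waves: "\<forall>t\<ge>0. \<forall>x. Q t Wm (x - Cm * t) = Wm x" "\<forall>t\<ge>0. \<forall>x. Q t Wp (x - Cp * t) = Wp x"
    using full[OF W(1) dyadic[OF w(4) W(1,3) wave_m C(3)]]
      full[OF W(2) dyadic[OF w(5) W(2,4) wave_p C(4)]] by blast+
  have "Cp \<le> Cm" using LIMSEQ_le[OF C(4,3)] w(2) by blast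
  have crosses: "crosses Wm lm" "crosses Wp lp"
    using crosses_wconv[OF W(3)] crosses_wconv[OF W(4)] w by blast+

  \<comment> \<open>End states of the limit waves and the choice between them\<close>
  have end_states: "\<exists>a b. (V \<longlongrightarrow> a) at_bot \<and> (V \<longlongrightarrow> b) at_top \<and> (\<forall>x. a \<le> V x \<and> V x \<le> b) \<and>
      a \<in> {0, \<alpha>, 1} \<and> b \<in> {0, \<alpha>, 1}"
    if V: "V \<in> MM" and wave: "\<forall>t\<ge>0. \<forall>x. Q t V (x - c * t) = V x" for V c
  proof -
    obtain a b where ab: "(V \<longlongrightarrow> a) at_bot" "(V \<longlongrightarrow> b) at_top" "0 \<le> a" "b \<le> 1"
      "\<And>x. a \<le> V x" "\<And>x. V x \<le> b"
      using MM_limits[OF V] by blast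
    have ab': "a \<le> 1" "0 \<le> b" using ab(3-4) ab(5)[of 0] ab(6)[of 0] by linarith+
    have wave1: "V x = Q 1 V (x - c)" for x using wave[rule_format, of 1 x] by simp
    \<comment> \<open>By (iv) the map \<open>Q 1\<close> strictly lowers constants between 0 and
      \<alpha> and strictly raises those between \<alpha> and 1.\<close>
    have fixed: "\<beta> \<in> {0, \<alpha>, 1}" if "Q 1 (\<lambda>_. \<beta>) = (\<lambda>_. \<beta>)" "0 \<le> \<beta>" "\<beta> \<le> 1" for \<beta>
    proof (rule ccontr)
      assume "\<beta> \<notin> {0, \<alpha>, 1}"
      with that have "0 < \<beta> \<and> \<beta> < \<alpha> \<or> \<alpha> < \<beta> \<and> \<beta> < 1" by auto
      then show False
        using that(1) Qiv2[of 1 \<beta>] Qiv3[of 1 \<beta>] by auto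
    qed
    have "a \<in> {0, \<alpha>, 1}"
    proof (rule fixed)
      show "Q 1 (\<lambda>_. a) = (\<lambda>_. a)"
      proof (rule front_map.wave_end_state[OF FM V wave1])
        fix x
        have "filterlim (\<lambda>k. x + - real k) at_bot sequentially"
          by (simp only: filterlim_tendsto_add_at_bot_iff[OF tendsto_const]
              filterlim_uminus_at_top[symmetric] filterlim_real_sequentially)
        then show "(\<lambda>k. V (x + - real k)) \<longlonglongrightarrow> a"
          by (rule filterlim_compose[OF ab(1)])
      qed (use ab ab' in auto)
    qed (use ab ab' in auto)
    moreover have "b \<in> {0, \<alpha>, 1}"
    proof (rule fixed)
      show "Q 1 (\<lambda>_. b) = (\<lambda>_. b)"
      proof (rule front_map.wave_end_state[OF FM V wave1])
        fix x
        have "filterlim (\<lambda>k. x + real k) at_top sequentially"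
          by (rule filterlim_tendsto_add_at_top[OF tendsto_const filterlim_real_sequentially])
        then show "(\<lambda>k. V (x + real k)) \<longlonglongrightarrow> b"
          by (rule filterlim_compose[OF ab(2)])
      qed (use ab ab' in auto)
    qed (use ab ab' in auto)
    ultimately show ?thesis using ab by blast
  qed
  obtain am bm where m: "(Wm \<longlongrightarrow> am) at_bot" "(Wm \<longlongrightarrow> bm) at_top" "\<forall>x. am \<le> Wm x \<and> Wm x \<le> bm"
    "am \<in> {0, \<alpha>, 1}" "bm \<in> {0, \<alpha>, 1}"
    using end_states[OF W(1) waves(1)] by blast
  obtain ap bp where p: "(Wp \<longlongrightarrow> ap) at_bot" "(Wp \<longlongrightarrow> bp) at_top" "\<forall>x. ap \<le> Wp x \<and> Wp x \<le> bp"
    "ap \<in> {0, \<alpha>, 1}" "bp \<in> {0, \<alpha>, 1}"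
    using end_states[OF W(2) waves(2)] by blast
  \<comment> \<open>Crossing a level strictly between 0 and \<alpha> forces the left state 0 and
    excludes 0 on the right.\<close>
  have "am \<le> Wm (- 1)" "Wm (- 1) \<le> lm" "lm \<le> Wm 1" "Wm 1 \<le> bm"
    using m(3) crosses(1) by (simp_all add: crosses_def)
  then have m': "am = 0" "bm = \<alpha> \<or> bm = 1" using m(4,5) lev alpha by auto
  have "ap \<le> Wp (- 1)" "Wp (- 1) \<le> lp" "lp \<le> Wp 1" "Wp 1 \<le> bp"
    using p(3) crosses(2) by (simp_all add: crosses_def)
  then have p': "ap = 0 \<or> ap = \<alpha>" "bp = 1" using p(4,5) lev alpha by auto
  \<comment> \<open>If both failed, the waves would join 0 to \<alpha> and \<alpha> to 1, and (c)
    would give \<open>Cm < Cp\<close> against \<open>Cp \<le> Cm\<close>.\<close>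
  have "bm = 1 \<or> ap = 0"
  proof (rule ccontr)
    assume "\<not> (bm = 1 \<or> ap = 0)"
    then have "bm = \<alpha>" "ap = \<alpha>" using m' p' by auto
    then have "Cm < Cp"
      using Qc[OF W(1,2) _ _ _ _ waves] m p m' p' by simp
    then show False using \<open>Cp \<le> Cm\<close> by simp
  qed
  then show ?thesis
  proof
    assume "bm = 1"
    then show ?thesis
      using m m' W(1) C(1) waves(1) by (intro exI[of _ Cm] exI[of _ Wm]) auto
  next
    assume "ap = 0"
    then show ?thesis
      using p p' W(2) C(2) waves(2) by (intro exI[of _ Cp] exI[of _ Wp]) auto
  qed
qed

end
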